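(* For every integer $n\ge 1$, one has $e_2(n-1,n)=s_2(n)$ if and only if $n=2^{\varepsilon}(2s+1)$ for some integers $\varepsilon,s$ with $0\le\varepsilon\le 2$, $s\ge 0$ and $\binom{3s}{s}$ odd.
   Context: $\nu_2(m)$ denotes the exponent of $2$ in the integer $m$, with $\nu_2(0)=\infty$; $[x]$ is the integer part of $x$. For integers $k\ge 0$ and $j\ge 0$ define the partial Stirling number $a_2(k,j)=\sum_{i\not\equiv 0\ (\mathrm{mod}\ 2)}(-1)^i\binom{j}{i}i^k$. For $k\ge 0$, $n\ge 1$ define $e_2(k,n)=\min\{\nu_2(a_2(k,j)) : j\ge n\}$. Define $s_2(n)=n-1+\nu_2([n/2]!)$. *)

theory Defs
  imports Complex_Main "HOL-Library.Extended_Nat" "HOL-Computational_Algebra.Primes"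
begin

(* The library's multiplicity 2 0 is 0, so the value \<infinity> at 0 is set explicitly. *)
definition nu2 :: "int \<Rightarrow> enat" where
  "nu2 m = (if m = 0 then \<infinity> else enat (multiplicity 2 m))"

(* The sum may be cut off at j because the binomial coefficient vanishes for i > j. *)
definition a2 :: "nat \<Rightarrow> nat \<Rightarrow> int" where
  "a2 k j = (\<Sum>i\<in>{i. i \<le> j \<and> odd i}. (-1) ^ i * int (j choose i) * int i ^ k)"

(* A nonempty subset of enat contains its infimum, so this is a minimum. *)
definition e2 :: "nat \<Rightarrow> nat \<Rightarrow> enat" where
  "e2 k n = (INF j\<in>{n..}. nu2 (a2 k j))"

(* Used for n \<ge> 1 only, where the subtraction does not truncate. *)
definition s2 :: "nat \<Rightarrow> enat" where
  "s2 n = enat (n - 1) + nu2 (fact (n div 2))"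

end

theory Submission
  imports Defs "HOL-Combinatorics.Stirling"
begin

text \<open>
  For \<open>j > k\<close> the full alternating sum of \<open>(j choose i) * i ^ k\<close> vanishes, so \<open>a2 k j\<close> equals
  \<open>- 2 ^ k\<close> times the sum of \<open>(j choose (2 * m)) * m ^ k\<close> over \<open>m\<close>. Expanding \<open>m ^ k\<close> in falling
  factorials gives a combination of the Stirling numbers \<open>Stirling k d\<close> whose coefficients
  \<open>d! * (\<Sum>m. (j choose (2 * m)) * (m choose d))\<close> have a product formula. With \<open>e = j div 2\<close>, the
  coefficient is an odd multiple of \<open>e!\<close> for \<open>d = e\<close>, is \<open>2 * e!\<close> times a 2-adic integer for
  \<open>d < e\<close>, and vanishes for \<open>d > e\<close>. Hence the sum is divisible by the 2-part of \<open>e!\<close>, and by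
  no more exactly if \<open>Stirling k e\<close> is odd. Equality in the theorem therefore means that
  \<open>Stirling (n - 1) e\<close> is odd for some \<open>e \<ge> n div 2\<close> with \<open>e!\<close> and \<open>(n div 2)!\<close> of equal 2-adic
  valuation, which leaves \<open>e = n div 2\<close> and, if \<open>n div 2\<close> is even, \<open>e = n div 2 + 1\<close>. The parity of
  Stirling numbers is that of a binomial coefficient.
\<close>

section \<open>Powers in falling factorials, and vanishing alternating sums\<close>

text \<open>Multiplying \<open>m choose d\<close> by \<open>m\<close> gives
  \<open>Suc d * (m choose Suc d) + d * (m choose d)\<close>, which reproduces the Stirling
  recurrence.\<close>

lemma power_eq_sum_Stirling:
  "m ^ k = (\<Sum>d\<le>k. Stirling k d * fact d * (m choose d))"
proof (induction k)
  case 0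
  show ?case by simp
next
  case (Suc k)
  have absorb: "m * (m choose d) = Suc d * (m choose Suc d) + d * (m choose d)" for d
  proof (cases "d \<le> m")
    case True
    then have "m * (m choose d) = (m - d) * (m choose d) + d * (m choose d)"
      by (simp flip: add_mult_distrib)
    then show ?thesis
      by (simp only: binomial_absorb_comp[symmetric] binomial_absorption)
  qed (simp add: binomial_eq_0)
  let ?t = "\<lambda>d. d * Stirling k d * fact d * (m choose d)"
  have shift: "(\<Sum>d\<le>k. ?t d) = (\<Sum>d\<le>k. ?t (Suc d))"
    using sum.atMost_Suc_shift[of ?t k] by simp
  have "m ^ Suc k = (\<Sum>d\<le>k. Stirling k d * fact d * (m * (m choose d)))"
    by (simp add: Suc sum_distrib_left mult_ac)
  also have "\<dots> = (\<Sum>d\<le>k. Stirling k d * fact (Suc d) * (m choose Suc d) + ?t d)"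
    by (simp only: absorb) (simp add: algebra_simps)
  also have "\<dots> = (\<Sum>d\<le>k. Stirling (Suc k) (Suc d) * fact (Suc d) * (m choose Suc d))"
    by (simp only: sum.distrib shift Stirling.simps add_mult_distrib)
  also have "\<dots> = (\<Sum>d\<le>Suc k. Stirling (Suc k) d * fact d * (m choose d))"
    by (subst sum.atMost_Suc_shift) simp
  finally show ?case .
qed

text \<open>The sum is the \<open>d\<close>-th Taylor coefficient at 1 of
  \<open>(1 - x) ^ j\<close>, a polynomial with a zero of order \<open>j\<close> there.\<close>

lemma alternating_sum_binomial_binomial:
  assumes "d < j"
  shows "(\<Sum>i\<le>j. (-1) ^ i * int (j choose i) * int (i choose d)) = 0"
  using assms
proof (induction j arbitrary: d)
  case (Suc j)
  let ?A = "\<lambda>N j d. \<Sum>i\<le>N. (-1) ^ i * int (j choose i) * int (i choose d)"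
  \<comment> \<open>Pascal's rule in the row splits the terms of index \<open>Suc i\<close> into
    \<open>X\<close> and \<open>Y\<close>. \<open>X\<close> cancels against row \<open>j\<close>,
    and Pascal's rule inside \<open>Y\<close> then lowers \<open>d\<close> along with
    \<open>j\<close>.\<close>
  define X where "X = (\<Sum>i\<le>j. (-1) ^ i * int (j choose Suc i) * int (Suc i choose d))"
  define Y where "Y = (\<Sum>i\<le>j. (-1) ^ i * int (j choose i) * int (Suc i choose d))"
  have "?A j j d = ?A (Suc j) j d" by simp
  also have "\<dots> = int (0 choose d) - X"
    by (subst sum.atMost_Suc_shift) (simp add: X_def sum_negf)
  finally have "?A j j d = int (0 choose d) - X" .
  moreover have "?A (Suc j) (Suc j) d = int (0 choose d) - (X + Y)"
    by (subst sum.atMost_Suc_shift)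
       (simp add: X_def Y_def sum_negf algebra_simps flip: sum.distrib)
  ultimately have "?A (Suc j) (Suc j) d = ?A j j d - Y" by linarith
  also have "\<dots> = (case d of 0 \<Rightarrow> 0 | Suc c \<Rightarrow> - ?A j j c)"
    by (cases d) (simp_all add: Y_def algebra_simps sum.distrib)
  also have "\<dots> = 0"
    using Suc by (cases d) auto
  finally show ?case .
qed simp

lemma alternating_sum_binomial_power:
  assumes "k < j"
  shows "(\<Sum>i\<le>j. (-1) ^ i * int (j choose i) * int i ^ k) = 0"
proof -
  have "(\<Sum>i\<le>j. (-1) ^ i * int (j choose i) * int i ^ k)
      = (\<Sum>i\<le>j. \<Sum>d\<le>k. int (Stirling k d * fact d) * ((-1) ^ i * int (j choose i) * int (i choose d)))"
    by (simp add: power_eq_sum_Stirling flip: of_nat_power) (simp add: sum_distrib_left mult_ac)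
  also have "\<dots> = (\<Sum>d\<le>k. int (Stirling k d * fact d)
      * (\<Sum>i\<le>j. (-1) ^ i * int (j choose i) * int (i choose d)))"
    by (subst sum.swap) (simp add: sum_distrib_left)
  also have "\<dots> = 0"
    using assms by (intro sum.neutral) (simp add: alternating_sum_binomial_binomial)
  finally show ?thesis .
qed

section \<open>Even-indexed sums and the product formula for the coefficients\<close>

text \<open>Terms with \<open>m\<close> beyond \<open>j div 2\<close> vanish; the generous range
  keeps index shifts free of division.\<close>

definition even_binomial_sum :: "nat \<Rightarrow> nat \<Rightarrow> nat" where
  "even_binomial_sum j d = (\<Sum>m\<le>j. (j choose (2 * m)) * (m choose d))"

definition even_power_sum :: "nat \<Rightarrow> nat \<Rightarrow> nat" where
  "even_power_sum j k = (\<Sum>m\<le>j. (j choose (2 * m)) * m ^ k)"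

lemma a2_eq_even_power_sum:
  assumes "k < j"
  shows "a2 k j = - (2 ^ k * int (even_power_sum j k))"
proof -
  let ?f = "\<lambda>i. (-1) ^ i * int (j choose i) * int i ^ k"
  have "a2 k j + (\<Sum>i\<in>{i. i \<le> j \<and> even i}. ?f i) = (\<Sum>i\<le>j. ?f i)"
    unfolding a2_def by (subst sum.union_disjoint[symmetric]) (auto intro!: sum.cong)
  moreover have "(\<Sum>i\<in>{i. i \<le> j \<and> even i}. ?f i) = (\<Sum>m\<in>{m. 2 * m \<le> j}. ?f (2 * m))"
    by (rule sum.reindex_bij_witness[of _ "\<lambda>m. 2 * m" "\<lambda>i. i div 2"]) auto
  moreover have "\<dots> = (\<Sum>m\<le>j. ?f (2 * m))"
    by (rule sum.mono_neutral_left) auto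
  moreover have "\<dots> = 2 ^ k * int (even_power_sum j k)"
    by (simp add: even_power_sum_def sum_distrib_left power_mult_distrib mult_ac)
  ultimately show ?thesis
    using alternating_sum_binomial_power[OF assms] by simp
qed

text \<open>
  The polynomials \<open>\<Sum>m. (j choose (2 * m)) * x ^ m = ((1 + sqrt x) ^ j + (1 - sqrt x) ^ j) / 2\<close>
  satisfy the linear recurrence with characteristic roots \<open>1 \<plusminus> sqrt x\<close>; this is its Taylor
  expansion at \<open>x = 1\<close>.
\<close>
lemma even_binomial_sum_Suc_Suc:
  "even_binomial_sum (Suc (Suc j)) (Suc d)
     = 2 * even_binomial_sum (Suc j) (Suc d) + even_binomial_sum j d"
proof -
  have upto: "even_binomial_sum i c = (\<Sum>m\<le>Suc (Suc j). (i choose (2 * m)) * (m choose c))"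
    if "i \<le> Suc (Suc j)" for i c
    unfolding even_binomial_sum_def using that
    by (intro sum.mono_neutral_left) auto
  have shift: "even_binomial_sum i (Suc d)
      = (\<Sum>m\<le>Suc j. (i choose (2 * m + 2)) * (Suc m choose Suc d))" if "i \<le> Suc (Suc j)" for i
    unfolding upto[OF that] by (subst sum.atMost_Suc_shift) simp
  have cut: "even_binomial_sum j c = (\<Sum>m\<le>Suc j. (j choose (2 * m)) * (m choose c))" for c
    by (simp add: upto)
  \<comment> \<open>The recurrence is \<open>p (j + 2) = 2 * p (j + 1) + (x - 1) * p j\<close>;
    moving \<open>- p j\<close> to the left avoids subtraction on naturals.\<close>
  have "even_binomial_sum (Suc (Suc j)) (Suc d) + even_binomial_sum j (Suc d)
      = (\<Sum>m\<le>Suc j. ((Suc (Suc j) choose (2 * m + 2)) + (j choose (2 * m + 2))) * (Suc m choose Suc d))"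
    by (simp only: shift le_refl le_SucI sum.distrib add_mult_distrib)
  \<comment> \<open>Pascal's rule, applied in both rows.\<close>
  also have "\<dots> = (\<Sum>m\<le>Suc j. (2 * (Suc j choose (2 * m + 2)) + (j choose (2 * m))) * (Suc m choose Suc d))"
    by (intro sum.cong) auto
  also have "\<dots> = 2 * even_binomial_sum (Suc j) (Suc d)
      + (\<Sum>m\<le>Suc j. (j choose (2 * m)) * (Suc m choose Suc d))"
    by (simp only: shift le_refl le_SucI sum.distrib add_mult_distrib sum_distrib_left mult.assoc)
  also have "(\<Sum>m\<le>Suc j. (j choose (2 * m)) * (Suc m choose Suc d))
      = even_binomial_sum j d + even_binomial_sum j (Suc d)"
    by (simp only: cut sum.distrib[symmetric]) (simp add: algebra_simps)
  finally show ?thesis by simp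
qed

lemma even_binomial_sum_0: "even_binomial_sum (Suc r) 0 = 2 ^ r"
proof -
  have "even_binomial_sum (Suc r) 0 = (\<Sum>m\<in>{m. 2 * m \<le> Suc r}. Suc r choose (2 * m))"
    unfolding even_binomial_sum_def by (rule sum.mono_neutral_cong_right) auto
  also have "\<dots> = (\<Sum>i\<in>{i. i \<le> Suc r \<and> even i}. Suc r choose i)"
    by (rule sum.reindex_bij_witness[of _ "\<lambda>i. i div 2" "\<lambda>m. 2 * m"]) auto
  also have "\<dots> = (\<Sum>i\<le>Suc r. if even i then Suc r choose i else 0)"
    by (subst sum.inter_filter[symmetric]) (auto intro!: sum.cong)
  finally have "2 * int (even_binomial_sum (Suc r) 0)
      = 2 * (\<Sum>i\<le>Suc r. if even i then of_nat (Suc r choose i) else 0)"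
    by (simp add: if_distrib[of int] del: sum.atMost_Suc cong: if_cong)
  also have "\<dots> = 2 ^ Suc r"
    by (rule choose_even_sum) simp
  finally have "int (even_binomial_sum (Suc r) 0) = int (2 ^ r)" by simp
  then show ?thesis by (simp only: of_nat_eq_iff)
qed

lemma even_binomial_sum_eq_0: "j < 2 * d \<Longrightarrow> even_binomial_sum j d = 0"
  unfolding even_binomial_sum_def by (auto intro!: sum.neutral)

lemma even_binomial_sum_double: "even_binomial_sum (2 * d) d = 1"
proof (induction d)
  case 0
  show ?case by (simp add: even_binomial_sum_def)
next
  case (Suc d)
  then show ?case
    using even_binomial_sum_Suc_Suc[of "2 * d" d] by (simp add: even_binomial_sum_eq_0)
qed

text \<open>Here \<open>Suc r\<close> is \<open>j - 2 * d\<close>. The induction follows the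
  recurrence: its first summand lowers \<open>r\<close>, its second lowers \<open>d\<close>.\<close>

lemma even_binomial_sum_closed_form:
  "fact (Suc r) * (fact d * even_binomial_sum (2 * d + Suc r) d)
     = 2 ^ r * fact (d + r) * (2 * d + Suc r)"
proof (induction d arbitrary: r)
  case 0
  show ?case by (simp add: even_binomial_sum_0 algebra_simps)
next
  case (Suc d)
  note IHd = Suc
  show ?case
  proof (induction r)
    case 0
    \<comment> \<open>At \<open>r = 0\<close> the first summand lies on the diagonal
      \<open>j = 2 * d\<close>, outside the formula's range, where the value is 1.\<close>
    have "even_binomial_sum (2 * Suc d + 1) (Suc d) = 2 + even_binomial_sum (2 * d + 1) d"
      using even_binomial_sum_Suc_Suc[of "2 * d + 1" d] even_binomial_sum_double[of "Suc d"]
      by simp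
    moreover have "fact d * even_binomial_sum (2 * d + 1) d = fact d * (2 * d + 1)"
      using IHd[of 0] by simp
    ultimately show ?case by (simp add: algebra_simps)
  next
    case (Suc r)
    have "fact (Suc (Suc r)) * (fact (Suc d) * even_binomial_sum (2 * Suc d + Suc (Suc r)) (Suc d))
      = 2 * Suc (Suc r) * (fact (Suc r) * (fact (Suc d) * even_binomial_sum (2 * Suc d + Suc r) (Suc d)))
        + Suc d * (fact (Suc (Suc r)) * (fact d * even_binomial_sum (2 * d + Suc (Suc r)) d))"
      using even_binomial_sum_Suc_Suc[of "2 * d + Suc (Suc r)" d] by (simp add: algebra_simps)
    also have "\<dots> = 2 * Suc (Suc r) * (2 ^ r * fact (Suc d + r) * (2 * Suc d + Suc r))
        + Suc d * (2 ^ Suc r * fact (d + Suc r) * (2 * d + Suc (Suc r)))"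
      by (simp only: Suc IHd)
    also have "\<dots> = 2 ^ Suc r * fact (Suc d + Suc r) * (2 * Suc d + Suc (Suc r))"
      by (simp add: algebra_simps)
    finally show ?case .
  qed
qed

section \<open>2-adic size of the coefficients and of the even power sums\<close>

text \<open>The even factors contribute \<open>2 ^ q * fact q\<close>; \<open>c\<close> is the
  product of the odd numbers below \<open>2 * q\<close>.\<close>

lemma fact_double_odd_part: "\<exists>c::nat. odd c \<and> fact (2 * q) = 2 ^ q * fact q * c"
proof (induction q)
  case 0
  show ?case by (intro exI[of _ 1]) simp
next
  case (Suc q)
  then obtain c :: nat where "odd c" "fact (2 * q) = 2 ^ q * fact q * c" by blast
  then show ?case
    by (intro exI[of _ "(2 * q + 1) * c"]) (simp add: algebra_simps)
qed

text \<open>With \<open>q = j div 2 - d\<close>, the denominator in the closed form is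
  \<open>fact (2 * q)\<close> or \<open>fact (2 * q + 1)\<close>. Its factor
  \<open>2 ^ q * fact q\<close> cancels, and the odd rest becomes the multiplier \<open>c\<close>,
  which expresses 2-adic divisibility within the naturals.\<close>

lemma odd_mult_even_binomial_sum:
  assumes "d < j div 2"
  shows "\<exists>c x. odd c \<and> c * (fact d * even_binomial_sum j d) = 2 * fact (j div 2) * x"
proof -
  define q where "q = j div 2 - d"
  have q: "0 < q" "j div 2 = d + q" using assms by (simp_all add: q_def)
  obtain c where c: "odd c" "fact (2 * q) = 2 ^ q * fact q * (c::nat)"
    using fact_double_odd_part by blast
  obtain p where p: "q = Suc p" using q(1) by (cases q) auto
  have fact_split: "fact (q + n) = fact q * (fact n * (q + n choose q))" for n :: nat
    using binomial_fact_lemma[of q "q + n"] by (simp add: mult_ac)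
  have cancel: "a = b" if "2 ^ q * fact q * a = 2 ^ q * fact q * b" for a b :: nat
    using that by simp
  show ?thesis
  proof (cases "even j")
    case True
    then have j: "j = 2 * d + Suc (2 * p + 1)" using q(2) p by auto
    have idx: "Suc (2 * p + 1) = 2 * q" "d + (2 * p + 1) = q + (d + p)"
      "2 * d + 2 * q = 2 * Suc (d + p)" by (simp_all add: p)
    have pow: "(2::nat) ^ (2 * p + 1) = 2 ^ q * 2 ^ p"
      unfolding power_add[symmetric] by (simp add: p mult_2)
    have "fact (2 * q) * (fact d * even_binomial_sum j d)
        = 2 ^ (2 * p + 1) * fact (q + (d + p)) * (2 * Suc (d + p))"
      using even_binomial_sum_closed_form[of "2 * p + 1" d] unfolding j idx .
    \<comment> \<open>The factor \<open>j = 2 * Suc (d + p)\<close> supplies the extra 2 and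
      completes \<open>fact (d + p)\<close> to \<open>fact (d + q)\<close>.\<close>
    also have "\<dots> = 2 ^ q * fact q * (2 * (Suc (d + p) * fact (d + p)) * (2 ^ p * (q + (d + p) choose q)))"
      unfolding fact_split pow by (simp only: mult_ac)
    also have "Suc (d + p) * fact (d + p) = fact (d + q)" by (simp add: p)
    finally have "2 ^ q * fact q * (c * (fact d * even_binomial_sum j d))
        = 2 ^ q * fact q * (2 * fact (d + q) * (2 ^ p * (q + (d + p) choose q)))"
      by (simp only: c(2) mult.assoc)
    then have "c * (fact d * even_binomial_sum j d)
        = 2 * fact (d + q) * (2 ^ p * (q + (d + p) choose q))"
      by (rule cancel)
    with c(1) show ?thesis unfolding q(2) by (intro exI conjI)
  next
    case False
    then have "2 * (j div 2) + 1 = j" by (rule odd_two_times_div_two_succ)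
    then have idx: "2 * d + Suc (2 * q) = j" "d + 2 * q = q + (d + q)" unfolding q(2) by simp_all
    \<comment> \<open>For odd \<open>j\<close> the extra 2 comes from the power:
      \<open>2 ^ q\<close> cancels, and \<open>2 ^ q = 2 * 2 ^ p\<close> remains because
      \<open>q > 0\<close>.\<close>
    have "2 * q = q + Suc p" using p by linarith
    then have pow: "(2::nat) ^ (2 * q) = 2 ^ q * (2 * 2 ^ p)"
      by (simp only: power_add power_Suc)
    have "Suc (2 * q) * fact (2 * q) * (fact d * even_binomial_sum j d)
        = 2 ^ (2 * q) * fact (q + (d + q)) * j"
      using even_binomial_sum_closed_form[of "2 * q" d] unfolding fact_Suc of_nat_id idx .
    also have "\<dots> = 2 ^ q * fact q * (2 * fact (d + q) * (2 ^ p * (q + (d + q) choose q) * j))"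
      unfolding fact_split pow by (simp only: mult_ac)
    finally have "2 ^ q * fact q * (Suc (2 * q) * c * (fact d * even_binomial_sum j d))
        = 2 ^ q * fact q * (2 * fact (d + q) * (2 ^ p * (q + (d + q) choose q) * j))"
      unfolding c(2) by (simp only: mult_ac)
    then have "Suc (2 * q) * c * (fact d * even_binomial_sum j d)
        = 2 * fact (d + q) * (2 ^ p * (q + (d + q) choose q) * j)"
      by (rule cancel)
    moreover have "odd (Suc (2 * q) * c)" using c(1) by simp
    ultimately show ?thesis unfolding q(2) by (intro exI conjI)
  qed
qed

text \<open>The odd factor is 1 for even \<open>j\<close> and \<open>j\<close> itself for odd
  \<open>j\<close>.\<close>

lemma even_binomial_sum_leading:
  "\<exists>c. odd c \<and> fact (j div 2) * even_binomial_sum j (j div 2) = fact (j div 2) * c"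
proof (cases "even j")
  case True
  then show ?thesis
    using even_binomial_sum_double[of "j div 2"] by (intro exI[of _ 1]) simp
next
  case False
  then have "fact (j div 2) * even_binomial_sum j (j div 2) = fact (j div 2) * j"
    using even_binomial_sum_closed_form[of 0 "j div 2"] by simp
  with False show ?thesis by blast
qed

lemma even_power_sum_eq_sum_Stirling:
  "even_power_sum j k = (\<Sum>d\<le>k. Stirling k d * (fact d * even_binomial_sum j d))"
proof -
  have "even_power_sum j k
      = (\<Sum>m\<le>j. \<Sum>d\<le>k. Stirling k d * fact d * ((j choose (2 * m)) * (m choose d)))"
    by (simp add: even_power_sum_def power_eq_sum_Stirling sum_distrib_left mult_ac)
  also have "\<dots> = (\<Sum>d\<le>k. Stirling k d * fact d * even_binomial_sum j d)"
    by (subst sum.swap) (simp add: even_binomial_sum_def sum_distrib_left)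
  finally show ?thesis by (simp add: mult_ac)
qed

lemma even_power_sum_decomposition:
  fixes k j
  defines "e \<equiv> j div 2"
  shows "\<exists>c y. odd c \<and>
    even_power_sum j k = Stirling k e * (fact e * c) + 2 ^ Suc (multiplicity 2 (fact e :: nat)) * y"
proof -
  let ?P = "2 ^ Suc (multiplicity 2 (fact e :: nat)) :: nat"
  let ?t = "\<lambda>d. Stirling k d * (fact d * even_binomial_sum j d)"
  have dvd: "?P dvd ?t d" if "d \<noteq> e" for d
  proof (cases "d < e")
    case True
    then obtain c x where c: "odd c" "c * (fact d * even_binomial_sum j d) = 2 * fact e * x"
      using odd_mult_even_binomial_sum[of d j] unfolding e_def by blast
    have "?P dvd 2 * fact e"
      by (simp add: mult_dvd_mono multiplicity_dvd)
    then have "?P dvd c * (fact d * even_binomial_sum j d)"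
      unfolding c(2) by (rule dvd_mult2)
    moreover have "coprime ?P c" using c(1) by simp
    ultimately have "?P dvd fact d * even_binomial_sum j d"
      by (simp only: coprime_dvd_mult_right_iff)
    then show ?thesis by (rule dvd_mult)
  next
    case False
    with that have "j < 2 * d" by (auto simp: e_def)
    then show ?thesis by (simp add: even_binomial_sum_eq_0)
  qed
  have split: "(\<Sum>d\<le>k + e. g d) = g e + (\<Sum>d\<in>{..k + e} - {e}. g d)" for g :: "nat \<Rightarrow> nat"
    by (rule sum.remove) auto
  \<comment> \<open>The range is enlarged so that \<open>d = e\<close> occurs even if
    \<open>e > k\<close>; the added terms have \<open>Stirling k d = 0\<close>.\<close>
  have "even_power_sum j k = (\<Sum>d\<le>k + e. ?t d)"
    unfolding even_power_sum_eq_sum_Stirling by (rule sum.mono_neutral_left) auto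
  also have "\<dots> = ?t e + (\<Sum>d\<in>{..k + e} - {e}. ?t d)"
    by (rule split)
  finally have "even_power_sum j k = ?t e + (\<Sum>d\<in>{..k + e} - {e}. ?t d)" .
  moreover have "?P dvd (\<Sum>d\<in>{..k + e} - {e}. ?t d)"
    using dvd by (intro dvd_sum) simp
  then obtain y where "(\<Sum>d\<in>{..k + e} - {e}. ?t d) = ?P * y" by (rule dvdE)
  moreover obtain c where "odd c" "fact e * even_binomial_sum j e = fact e * c"
    using even_binomial_sum_leading[of j] unfolding e_def by blast
  ultimately have "even_power_sum j k = Stirling k e * (fact e * c) + ?P * y" by simp
  with \<open>odd c\<close> show ?thesis by blast
qed

lemma
  fixes k j
  defines "v \<equiv> multiplicity 2 (fact (j div 2) :: nat)"
  shows power_dvd_even_power_sum: "2 ^ v dvd even_power_sum j k"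
    and Suc_power_dvd_even_power_sum_iff:
      "2 ^ Suc v dvd even_power_sum j k \<longleftrightarrow> even (Stirling k (j div 2))"
proof -
  obtain c y where c: "odd c" and eq: "even_power_sum j k
      = Stirling k (j div 2) * (fact (j div 2) * c) + 2 ^ Suc v * y"
    using even_power_sum_decomposition[of j k, folded v_def] by blast
  obtain z where z: "fact (j div 2) = 2 ^ v * z" "odd (z::nat)"
    unfolding v_def by (rule multiplicity_decompose'[of "fact (j div 2) :: nat" 2]) simp_all
  \<comment> \<open>As \<open>z * c\<close> is odd, the bracket has the parity of the Stirling
    number.\<close>
  have eq': "even_power_sum j k = 2 ^ v * (Stirling k (j div 2) * (z * c) + 2 * y)"
    unfolding eq z by (simp add: algebra_simps)
  then show "2 ^ v dvd even_power_sum j k" by simp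
  show "2 ^ Suc v dvd even_power_sum j k \<longleftrightarrow> even (Stirling k (j div 2))"
    unfolding eq' using c z(2) by (simp add: power_Suc2 del: power_Suc)
qed

section \<open>Valuations of factorials and minima in \<open>enat\<close>\<close>

lemma multiplicity_2_fact_mono:
  assumes "m \<le> n"
  shows "multiplicity 2 (fact m :: nat) \<le> multiplicity 2 (fact n :: nat)"
  using assms by (intro dvd_imp_multiplicity_le) (auto simp: fact_dvd)

lemma multiplicity_2_fact_Suc:
  "multiplicity 2 (fact (Suc n) :: nat) = multiplicity 2 (Suc n) + multiplicity 2 (fact n :: nat)"
  unfolding fact_Suc of_nat_id by (rule prime_elem_multiplicity_mult_distrib) auto

text \<open>Passing from \<open>fact i\<close> to \<open>fact (Suc i)\<close> keeps the valuation
  exactly if \<open>i\<close> is even, so two consecutive steps always raise it.\<close>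

lemma multiplicity_2_fact_eq_iff:
  assumes "m \<le> n"
  shows "multiplicity 2 (fact n :: nat) = multiplicity 2 (fact m :: nat)
    \<longleftrightarrow> n = m \<or> even m \<and> n = Suc m"
proof -
  have step: "multiplicity 2 (fact (Suc i) :: nat) = multiplicity 2 (fact i :: nat) \<longleftrightarrow> even i" for i
    unfolding multiplicity_2_fact_Suc by (auto simp: multiplicity_eq_zero_iff)
  show ?thesis
  proof (cases "n \<le> Suc m")
    case True
    then show ?thesis using assms step[of m] by (cases "n = m") (auto simp: le_Suc_eq)
  next
    case False
    then have "multiplicity 2 (fact (Suc (Suc m)) :: nat) \<le> multiplicity 2 (fact n :: nat)"
      by (intro multiplicity_2_fact_mono) simp
    moreover have "multiplicity 2 (fact m :: nat) < multiplicity 2 (fact (Suc (Suc m)) :: nat)"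
      using step[of m] step[of "Suc m"] multiplicity_2_fact_mono[of m "Suc m"]
        multiplicity_2_fact_mono[of "Suc m" "Suc (Suc m)"] by (cases "even m") auto
    ultimately show ?thesis using False by auto
  qed
qed

lemma enat_le_nu2_iff: "enat N \<le> nu2 x \<longleftrightarrow> 2 ^ N dvd x"
  by (cases "x = 0") (simp_all add: nu2_def power_dvd_iff_le_multiplicity)

lemma nu2_fact: "nu2 (fact m) = enat (multiplicity 2 (fact m :: nat))"
proof -
  let ?v = "multiplicity 2 (fact m :: nat)"
  have dvd: "(2 ^ i :: int) dvd fact m \<longleftrightarrow> i \<le> ?v" for i
  proof -
    have "(2 ^ i :: int) dvd fact m \<longleftrightarrow> int (2 ^ i) dvd int (fact m)" by simp
    also have "\<dots> \<longleftrightarrow> i \<le> ?v"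
      unfolding int_dvd_int_iff by (rule power_dvd_iff_le_multiplicity) auto
    finally show ?thesis .
  qed
  have "multiplicity 2 (fact m :: int) = ?v"
    by (intro multiplicity_eqI) (simp_all add: dvd flip: power_Suc)
  then show ?thesis by (simp add: nu2_def)
qed

text \<open>Turns a statement about a minimum into an existence statement: the infimum exceeds the
  lower bound \<open>N\<close> exactly if \<open>Suc N\<close> is a lower bound too.\<close>

lemma INF_enat_eq_iff:
  fixes f :: "'a \<Rightarrow> enat"
  assumes "\<And>x. x \<in> A \<Longrightarrow> enat N \<le> f x"
  shows "(INF x\<in>A. f x) = enat N \<longleftrightarrow> (\<exists>x\<in>A. \<not> enat (Suc N) \<le> f x)"
proof -
  have "enat N \<le> (INF x\<in>A. f x)" using assms by (intro INF_greatest)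
  then have "(INF x\<in>A. f x) = enat N \<longleftrightarrow> \<not> enat (Suc N) \<le> (INF x\<in>A. f x)"
    by (cases "INF x\<in>A. f x") auto
  then show ?thesis by (simp add: le_INF_iff)
qed

section \<open>Reduction of the equality to parities of Stirling numbers\<close>

lemma e2_eq_s2_iff_Stirling:
  assumes "n \<ge> 1"
  defines "f \<equiv> n div 2"
  shows "e2 (n - 1) n = s2 n \<longleftrightarrow>
    odd (Stirling (n - 1) f) \<or> even f \<and> odd (Stirling (n - 1) (Suc f))"
proof -
  let ?v = "\<lambda>m. multiplicity 2 (fact m :: nat)"
  define N where "N = n - 1 + ?v f"
  have dvd_iff: "enat (n - 1 + i) \<le> nu2 (a2 (n - 1) j) \<longleftrightarrow> 2 ^ i dvd even_power_sum j (n - 1)"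
    if "j \<ge> n" for i j
  proof -
    have "a2 (n - 1) j = - (2 ^ (n - 1) * int (even_power_sum j (n - 1)))"
      using that assms by (intro a2_eq_even_power_sum) simp
    then have "enat (n - 1 + i) \<le> nu2 (a2 (n - 1) j) \<longleftrightarrow> int (2 ^ i) dvd int (even_power_sum j (n - 1))"
      by (simp add: enat_le_nu2_iff power_add)
    then show ?thesis by (simp only: int_dvd_int_iff)
  qed
  have lower: "enat N \<le> nu2 (a2 (n - 1) j)" if "j \<in> {n..}" for j
  proof -
    have "?v f \<le> ?v (j div 2)"
      using that unfolding f_def by (intro multiplicity_2_fact_mono div_le_mono) simp
    then have "2 ^ ?v f dvd even_power_sum j (n - 1)"
      using power_dvd_even_power_sum[of j] le_imp_power_dvd dvd_trans by blast
    then show ?thesis using dvd_iff that by (simp add: N_def)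
  qed
  have sharp: "\<not> enat (Suc N) \<le> nu2 (a2 (n - 1) j) \<longleftrightarrow>
      (j div 2 = f \<or> even f \<and> j div 2 = Suc f) \<and> odd (Stirling (n - 1) (j div 2))"
    if "j \<in> {n..}" for j
  proof -
    have le: "f \<le> j div 2" using that unfolding f_def by (intro div_le_mono) simp
    show ?thesis
    proof (cases "?v (j div 2) = ?v f")
      case True
      then show ?thesis
        using dvd_iff[of j "Suc (?v f)"] Suc_power_dvd_even_power_sum_iff[of j "n - 1"] that
          multiplicity_2_fact_eq_iff[OF le] by (simp add: N_def)
    next
      case False
      then have "Suc (?v f) \<le> ?v (j div 2)"
        using multiplicity_2_fact_mono[OF le] by simp
      then have "2 ^ Suc (?v f) dvd even_power_sum j (n - 1)"
        using power_dvd_even_power_sum[of j] le_imp_power_dvd dvd_trans by blast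
      moreover have "\<not> (j div 2 = f \<or> even f \<and> j div 2 = Suc f)"
        using False multiplicity_2_fact_eq_iff[OF le] by simp
      ultimately show ?thesis
        using dvd_iff[of j "Suc (?v f)"] that by (auto simp: N_def)
    qed
  qed
  have "s2 n = enat N" by (simp add: s2_def nu2_fact N_def f_def)
  then have "e2 (n - 1) n = s2 n \<longleftrightarrow> (\<exists>j\<in>{n..}. \<not> enat (Suc N) \<le> nu2 (a2 (n - 1) j))"
    unfolding e2_def using INF_enat_eq_iff[of "{n..}" N] lower by simp
  also have "\<dots> \<longleftrightarrow> (\<exists>j\<in>{n..}. (j div 2 = f \<or> even f \<and> j div 2 = Suc f)
      \<and> odd (Stirling (n - 1) (j div 2)))"
    by (simp only: sharp cong: bex_cong)
  also have "\<dots> \<longleftrightarrow> odd (Stirling (n - 1) f) \<or> even f \<and> odd (Stirling (n - 1) (Suc f))"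
  proof
    assume R: "odd (Stirling (n - 1) f) \<or> even f \<and> odd (Stirling (n - 1) (Suc f))"
    \<comment> \<open>The witnesses for \<open>f\<close> and \<open>Suc f\<close> are
      \<open>j = n\<close> and \<open>j = n + 2\<close>.\<close>
    have "n \<in> {n..}" "n div 2 = f" "n + 2 \<in> {n..}" "(n + 2) div 2 = Suc f"
      by (simp_all add: f_def)
    with R show "\<exists>j\<in>{n..}. (j div 2 = f \<or> even f \<and> j div 2 = Suc f)
      \<and> odd (Stirling (n - 1) (j div 2))" by metis
  qed auto
  finally show ?thesis .
qed

section \<open>Stirling numbers and binomial coefficients modulo 2\<close>

text \<open>Modulo 2 the generating function of column \<open>2 * a + 1\<close> is
  \<open>x ^ (2 * a + 1) / (1 - x) ^ (a + 1)\<close>. The proof matches the Stirling recurrence with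
  Pascal's rule.\<close>

lemma even_Stirling_odd_iff:
  "even (Stirling (Suc (2 * a + b)) (Suc (2 * a))) \<longleftrightarrow> even (a + b choose b)"
proof (induction "a + b" arbitrary: a b)
  case 0
  then show ?case by simp
next
  case (Suc n)
  show ?case
  proof (cases a)
    case 0
    then show ?thesis by (simp del: Stirling.simps)
  next
    case a: (Suc a')
    show ?thesis
    proof (cases b)
      case 0
      then show ?thesis by simp
    next
      case b: (Suc b')
      \<comment> \<open>In an even column the recurrence has the even factor \<open>2 * a\<close>,
        so only the term lowering both indices survives.\<close>
      have "even (Stirling (2 * a + b) (2 * a)) \<longleftrightarrow> even (Stirling (Suc (2 * a' + b)) (Suc (2 * a')))"
        by (simp add: a)
      also have "\<dots> \<longleftrightarrow> even (a' + b choose b)"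
        using Suc.hyps(1)[of a' b] Suc.hyps(2) a by simp
      finally have "even (Stirling (2 * a + b) (2 * a)) \<longleftrightarrow> even (a' + b choose b)" .
      moreover have "even (Stirling (Suc (2 * a + b')) (Suc (2 * a))) \<longleftrightarrow> even (a + b' choose b')"
        using Suc.hyps(1)[of a b'] Suc.hyps(2) b by simp
      moreover have "Stirling (Suc (2 * a + b)) (Suc (2 * a))
          = Suc (2 * a) * Stirling (Suc (2 * a + b')) (Suc (2 * a)) + Stirling (2 * a + b) (2 * a)"
        by (simp add: b del: Stirling.simps) (simp add: Stirling.simps)
      moreover have "(a + b choose b) = (a + b' choose b') + (a' + b choose b)"
        by (simp add: a b)
      ultimately show ?thesis by (simp del: Stirling.simps)
    qed
  qed
qed

lemma even_Stirling_even_iff: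
  "even (Stirling (2 * a + 2 + b) (2 * a + 2)) \<longleftrightarrow> even (a + b choose b)"
  using even_Stirling_odd_iff[of a b] by simp

text \<open>Lucas's theorem modulo 2 for the last binary digit. Each row follows from the preceding
  one by Pascal's rule, so the four claims share one induction.\<close>

lemma even_binomial_mod_2:
  "even (2 * a choose (2 * b)) \<longleftrightarrow> even (a choose b)"
  "even (Suc (2 * a) choose (2 * b)) \<longleftrightarrow> even (a choose b)"
  "even (Suc (2 * a) choose Suc (2 * b)) \<longleftrightarrow> even (a choose b)"
  "even (2 * a choose Suc (2 * b))"
proof (induction a arbitrary: b)
  case 0
  case 1 show ?case by (cases b) simp_all
  case 2 show ?case by (cases b) simp_all
  case 3 show ?case by (cases b) simp_all
  case 4 show ?case by simp
next
  case (Suc a)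
  note [simp del] = binomial_Suc_Suc
  have even_top: "even (2 * Suc a choose (2 * c)) \<longleftrightarrow> even (Suc a choose c)" for c
  proof (cases c)
    case (Suc b)
    have "(2 * Suc a choose (2 * c)) = (Suc (2 * a) choose Suc (2 * b)) + (Suc (2 * a) choose (2 * c))"
      by (simp add: Suc binomial_Suc_Suc)
    moreover have "(Suc a choose c) = (a choose b) + (a choose c)"
      by (simp add: Suc binomial_Suc_Suc)
    ultimately show ?thesis by (simp only: even_add Suc.IH)
  qed simp
  have odd_bottom: "even (2 * Suc a choose Suc (2 * c))" for c
  proof -
    have "(2 * Suc a choose Suc (2 * c)) = (Suc (2 * a) choose (2 * c)) + (Suc (2 * a) choose Suc (2 * c))"
      by (simp add: binomial_Suc_Suc)
    then show ?thesis by (simp only: even_add Suc.IH)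
  qed
  case 1 show ?case by (rule even_top)
  case 2 show ?case
  proof (cases b)
    case (Suc c)
    have "(Suc (2 * Suc a) choose (2 * b)) = (2 * Suc a choose Suc (2 * c)) + (2 * Suc a choose (2 * b))"
      by (simp add: Suc binomial_Suc_Suc)
    then show ?thesis by (simp only: even_add even_top odd_bottom simp_thms)
  qed simp
  case 3 show ?case
    by (simp only: binomial_Suc_Suc even_add even_top odd_bottom simp_thms)
  case 4 show ?case by (rule odd_bottom)
qed

text \<open>The absorption identities show that Pascal's rule splits \<open>3 * t choose t\<close>
  in the ratio 2 : 1. Since 3 is odd, this determines the parities of both parts.\<close>

lemma three_times_binomial:
  assumes "t > 0"
  shows "3 * (3 * t - 1 choose t) = 2 * (3 * t choose t)"
    and "3 * (3 * t - 1 choose (t - 1)) = (3 * t choose t)"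
proof -
  have "t * (3 * (3 * t - 1 choose t)) = t * (2 * (3 * t choose t))"
    using binomial_absorb_comp[of "3 * t" t] by auto
  then show "3 * (3 * t - 1 choose t) = 2 * (3 * t choose t)"
    using assms by simp
  have "t * (3 * (3 * t - 1 choose (t - 1))) = t * (3 * t choose t)"
    using binomial_absorption[of "t - 1" "3 * t"] assms by simp
  then show "3 * (3 * t - 1 choose (t - 1)) = (3 * t choose t)"
    using assms by simp
qed

lemma even_three_times_binomial:
  assumes "t > 0"
  shows "even (3 * t - 1 choose t)"
    and "even (3 * t - 1 choose (t - 1)) \<longleftrightarrow> even (3 * t choose t)"
proof -
  have "even (3 * (3 * t - 1 choose t))"
    unfolding three_times_binomial(1)[OF assms] by simp
  then show "even (3 * t - 1 choose t)" by simp
  show "even (3 * t - 1 choose (t - 1)) \<longleftrightarrow> even (3 * t choose t)"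
    unfolding three_times_binomial(2)[OF assms, symmetric] by simp
qed

section \<open>Comparison with the parity of \<open>3 * s choose s\<close>\<close>

text \<open>The case \<open>n = 2 * s + 1\<close>. For positive even \<open>s\<close> the second
  Stirling number is even, so the first alone decides.\<close>

lemma Stirling_parity_odd:
  "odd (Stirling (2 * s) s) \<or> even s \<and> odd (Stirling (2 * s) (Suc s)) \<longleftrightarrow> odd (3 * s choose s)"
proof (cases "even s")
  case True
  then obtain t where s: "s = 2 * t" by (rule evenE)
  show ?thesis
  proof (cases "t = 0")
    case True
    then show ?thesis by (simp add: s del: Stirling.simps binomial_Suc_Suc)
  next
    case False
    then have t: "t > 0" by simp
    \<comment> \<open>Index identities that bring both Stirling numbers into the shape of the parity
      lemmas.\<close>
    then have idx: "2 * (t - 1) + 2 = s" "s + 2 * t = 2 * s" "t - 1 + 2 * t = 3 * t - 1"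
      "Suc (2 * t + (2 * t - 1)) = 2 * s" "Suc (2 * t) = Suc s" "t + (2 * t - 1) = 3 * t - 1"
      by (simp_all add: s)
    have "even (Stirling (2 * s) s) \<longleftrightarrow> even (3 * t - 1 choose (2 * t))"
      using even_Stirling_even_iff[of "t - 1" "2 * t"] unfolding idx .
    also have "(3 * t - 1 choose (2 * t)) = (3 * t - 1 choose (t - 1))"
      using binomial_symmetric[of "2 * t" "3 * t - 1"] t by simp
    also have "even \<dots> \<longleftrightarrow> even (3 * t choose t)"
      by (rule even_three_times_binomial[OF t])
    also have "\<dots> \<longleftrightarrow> even (3 * s choose s)"
      using even_binomial_mod_2(1)[of "3 * t" t] by (simp add: s del: Stirling.simps binomial_Suc_Suc)
    finally have 1: "even (Stirling (2 * s) s) \<longleftrightarrow> even (3 * s choose s)" .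
    have "even (Stirling (2 * s) (Suc s)) \<longleftrightarrow> even (3 * t - 1 choose (2 * t - 1))"
      using even_Stirling_odd_iff[of t "2 * t - 1"] unfolding idx .
    also have "(3 * t - 1 choose (2 * t - 1)) = (3 * t - 1 choose t)"
      using binomial_symmetric[of t "3 * t - 1"] t by simp
    finally have "even (Stirling (2 * s) (Suc s))"
      using even_three_times_binomial(1)[OF t] by blast
    with 1 show ?thesis by blast
  qed
next
  case False
  then obtain t where s: "s = 2 * t + 1" by (rule oddE)
  have "even (Stirling (2 * s) s) \<longleftrightarrow> even (3 * t + 1 choose (2 * t + 1))"
    using even_Stirling_odd_iff[of t "2 * t + 1"] by (simp add: s del: Stirling.simps binomial_Suc_Suc)
  also have "(3 * t + 1 choose (2 * t + 1)) = (3 * t + 1 choose t)"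
    using binomial_symmetric[of t "3 * t + 1"] by simp
  finally have "even (Stirling (2 * s) s) \<longleftrightarrow> even (3 * t + 1 choose t)" .
  moreover have "even (3 * s choose s) \<longleftrightarrow> even (3 * t + 1 choose t)"
  proof -
    have "3 * s = Suc (2 * (3 * t + 1))" "s = Suc (2 * t)" by (simp_all add: s)
    then show ?thesis by (simp only: even_binomial_mod_2(3))
  qed
  ultimately show ?thesis using False by blast
qed

text \<open>The case \<open>n = 2 * f\<close>. Odd \<open>f\<close> belongs to \<epsilon> = 1 and
  twice an odd number to \<epsilon> = 2; if 4 divides \<open>f\<close>, both Stirling numbers are
  even.\<close>

lemma Stirling_parity_even:
  assumes "f > 0"
  shows "odd (Stirling (2 * f - 1) f) \<or> even f \<and> odd (Stirling (2 * f - 1) (Suc f))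
    \<longleftrightarrow> (\<exists>s. (f = 2 * s + 1 \<or> f = 2 * (2 * s + 1)) \<and> odd (3 * s choose s))"
proof (cases "even f")
  case False
  then obtain t where f: "f = 2 * t + 1" by (rule oddE)
  have "even (Stirling (2 * f - 1) f) \<longleftrightarrow> even (3 * t choose (2 * t))"
    using even_Stirling_odd_iff[of t "2 * t"] by (simp add: f)
  also have "(3 * t choose (2 * t)) = (3 * t choose t)"
    using binomial_symmetric[of t "3 * t"] by simp
  finally have "even (Stirling (2 * f - 1) f) \<longleftrightarrow> even (3 * t choose t)" .
  moreover have "f = 2 * s + 1 \<or> f = 2 * (2 * s + 1) \<longleftrightarrow> s = t" for s
    unfolding f by presburger
  ultimately show ?thesis using False by simp
next
  case True
  then obtain t where f: "f = 2 * t" by (rule evenE)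
  with assms obtain u where t: "t = Suc u" by (cases t) auto
  have "even (Stirling (2 * f - 1) f) \<longleftrightarrow> even (3 * u + 1 choose (2 * u + 1))"
    using even_Stirling_even_iff[of u "2 * u + 1"]
    by (simp add: f t del: Stirling.simps binomial_Suc_Suc)
  also have "(3 * u + 1 choose (2 * u + 1)) = (3 * u + 1 choose u)"
    using binomial_symmetric[of u "3 * u + 1"] by simp
  finally have 1: "even (Stirling (2 * f - 1) f) \<longleftrightarrow> even (3 * u + 1 choose u)" .
  have "even (Stirling (2 * f - 1) (Suc f)) \<longleftrightarrow> even (3 * u + 1 choose (2 * u))"
    using even_Stirling_odd_iff[of t "2 * u"]
    by (simp add: f t del: Stirling.simps binomial_Suc_Suc)
  also have "(3 * u + 1 choose (2 * u)) = (3 * u + 1 choose Suc u)"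
    using binomial_symmetric[of "Suc u" "3 * u + 1"] by simp
  finally have 2: "even (Stirling (2 * f - 1) (Suc f)) \<longleftrightarrow> even (3 * u + 1 choose Suc u)" .
  have iff: "odd (Stirling (2 * f - 1) f) \<or> even f \<and> odd (Stirling (2 * f - 1) (Suc f))
      \<longleftrightarrow> odd (3 * u + 1 choose u) \<or> odd (3 * u + 1 choose Suc u)"
    using True by (simp only: 1 2 simp_thms)
  show ?thesis
  proof (cases "even u")
    case True
    then obtain s where u: "u = 2 * s" by (rule evenE)
    have "f = 2 * s' + 1 \<or> f = 2 * (2 * s' + 1) \<longleftrightarrow> s' = s" for s'
      unfolding f t u by presburger
    \<comment> \<open>With \<open>u = 2 * s\<close>, both binomials of row \<open>6 * s + 1\<close>
      have the parity of \<open>3 * s choose s\<close>.\<close>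
    then show ?thesis
      unfolding iff using even_binomial_mod_2(2,3)[of "3 * s" s]
      by (simp add: u del: binomial_Suc_Suc)
  next
    case False
    then obtain s where u: "u = 2 * s + 1" by (rule oddE)
    \<comment> \<open>Here 4 divides \<open>f\<close>. The row is even: an odd lower index gives an
      even binomial, and the lower index \<open>Suc u\<close> leads to
      \<open>3 * Suc s - 1 choose Suc s\<close>, which is even.\<close>
    have idx: "2 * (3 * s + 2) = 3 * u + 1" "Suc (2 * s) = u" "2 * Suc s = Suc u"
      "3 * s + 2 = 3 * Suc s - 1" by (simp_all add: u)
    have "\<not> (\<exists>s. f = 2 * s + 1 \<or> f = 2 * (2 * s + 1))"
      unfolding f t u by presburger
    moreover have "even (3 * u + 1 choose u)"
      using even_binomial_mod_2(4)[of "3 * s + 2" s] unfolding idx(1,2) .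
    moreover have "even (3 * u + 1 choose Suc u)"
      using even_three_times_binomial(1)[of "Suc s"] even_binomial_mod_2(1)[of "3 * s + 2" "Suc s"]
      unfolding idx(1,3) unfolding idx(4) by blast
    ultimately show ?thesis unfolding iff by blast
  qed
qed

section \<open>The equivalence, by the parity of \<open>n\<close>\<close>

theorem theorem1p7:
  fixes n :: nat
  assumes "n \<ge> 1"
  shows "e2 (n - 1) n = s2 n \<longleftrightarrow>
    (\<exists>\<epsilon> s :: nat. \<epsilon> \<le> 2 \<and> n = 2 ^ \<epsilon> * (2 * s + 1) \<and> odd ((3 * s) choose s))"
proof -
  let ?Q = "\<lambda>\<epsilon> s. n = 2 ^ \<epsilon> * (2 * s + 1) \<and> odd ((3 * s) choose s)"
  have ex_le_2: "(\<exists>\<epsilon>\<le>2. P \<epsilon>) \<longleftrightarrow> P 0 \<or> P 1 \<or> P 2" for P :: "nat \<Rightarrow> bool"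
    by (auto simp: numeral_2_eq_2 le_Suc_eq)
  have "(\<exists>\<epsilon> s :: nat. \<epsilon> \<le> 2 \<and> ?Q \<epsilon> s) \<longleftrightarrow> (\<exists>\<epsilon>\<le>2. \<exists>s. ?Q \<epsilon> s)" by blast
  also have "\<dots> \<longleftrightarrow> (\<exists>s. ?Q 0 s) \<or> (\<exists>s. ?Q 1 s) \<or> (\<exists>s. ?Q 2 s)" by (rule ex_le_2)
  also have "\<dots> \<longleftrightarrow> (\<exists>s. (n = 2 * s + 1 \<or> n = 2 * (2 * s + 1) \<or> n = 4 * (2 * s + 1))
      \<and> odd ((3 * s) choose s))"
    unfolding ex_disj_distrib[symmetric] by (intro arg_cong[where f = Ex] ext) auto
  also have "\<dots> \<longleftrightarrow> e2 (n - 1) n = s2 n"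
  proof (cases "even n")
    case True
    then obtain f where n: "n = 2 * f" by (rule evenE)
    then have f: "f > 0" "n - 1 = 2 * f - 1" "n div 2 = f" using assms by simp_all
    have solve: "n = 2 * s + 1 \<or> n = 2 * (2 * s + 1) \<or> n = 4 * (2 * s + 1)
        \<longleftrightarrow> f = 2 * s + 1 \<or> f = 2 * (2 * s + 1)" for s
    proof -
      have "2 * f \<noteq> 2 * s + 1" by presburger
      then show ?thesis by (auto simp: n)
    qed
    show ?thesis
      unfolding e2_eq_s2_iff_Stirling[OF assms] unfolding f(2,3) Stirling_parity_even[OF f(1)] solve ..
  next
    case False
    then obtain s where n: "n = 2 * s + 1" by (rule oddE)
    then have s: "n - 1 = 2 * s" "n div 2 = s" by simp_all
    \<comment> \<open>For odd \<open>n\<close> only \<epsilon> = 0 is possible, and \<open>n\<close>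
      determines \<open>s\<close>.\<close>
    have solve: "n = 2 * s' + 1 \<or> n = 2 * (2 * s' + 1) \<or> n = 4 * (2 * s' + 1) \<longleftrightarrow> s' = s" for s'
    proof -
      have "n \<noteq> 2 * (2 * s' + 1)" "n \<noteq> 4 * (2 * s' + 1)" using False by auto
      then show ?thesis using n by auto
    qed
    show ?thesis
      unfolding e2_eq_s2_iff_Stirling[OF assms] unfolding s Stirling_parity_odd solve by blast
  qed
  finally show ?thesis by (rule sym)
qed

end
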